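(* Let $X$ be a geodesic metric space. Then $X$ is hyperbolic if and only if $$\limsup_{t\to\infty}\frac{\Omega_X(t)}{t}<\frac{1}{32}.$$
   Context: Let $(X,d)$ be a metric space. A map $\gamma\colon[0,1]\to X$ is a geodesic if there is $k\ge 0$ with $d(\gamma(t),\gamma(s))=k|t-s|$ for all $t,s\in[0,1]$; geodesics are identified with their images. $X$ is geodesic if any two of its points can be joined by a geodesic. A triangle $\Delta=\Delta(x,y,z)$ with vertices $x,y,z$ is the union of three geodesics $[x,y],[y,z],[z,x]$ (its sides) joining the vertices pairwise; its perimeter is $\mathrm{pr}(\Delta)=d(x,y)+d(y,z)+d(z,x)$. A triangle with sides $\ell_1,\ell_2,\ell_3$ satisfies the Rips condition with constant $\delta$ if, whenever $\{i,j,k\}=\{1,2,3\}$, every point of $\ell_i$ is at distance at most $\delta$ from $\ell_j\cup\ell_k$. A geodesic space $X$ is $\delta$-hyperbolic if every triangle in $X$ satisfies the Rips condition with constant $\delta$, and it is hyperbolic if it is $\delta$-hyperbolic for some $\delta\ge 0$. For a triangle $\Delta$ in $X$ let $\delta(\Delta)=\inf\{\delta:\ \Delta \text{ satisfies the Rips condition with constant } \delta\}$. The function $\Omega_X$ is defined on positive reals by $\Omega_X(t)=\sup\{\delta(\Delta):\ \Delta \text{ a triangle in } X \text{ with } \mathrm{pr}(\Delta)\le t\}$. *)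

theory Defs
  imports "HOL-Analysis.Analysis"
begin

text \<open>
  A metric space is given as a set \<open>X\<close> in a type of class \<open>metric_space\<close>, with the induced
  distance. Values that are infima or suprema are taken in \<open>ereal\<close>, so that none of them
  depends on the convention for unbounded or empty sets of reals.
\<close>

definition geodesic :: "'a::metric_space set \<Rightarrow> (real \<Rightarrow> 'a) \<Rightarrow> bool" where
  "geodesic X \<gamma> \<longleftrightarrow> \<gamma> ` {0..1} \<subseteq> X \<and>
     (\<exists>k\<ge>0. \<forall>t\<in>{0..1}. \<forall>s\<in>{0..1}. dist (\<gamma> t) (\<gamma> s) = k * \<bar>t - s\<bar>)"

definition geodesic_segment :: "'a::metric_space set \<Rightarrow> 'a \<Rightarrow> 'a \<Rightarrow> 'a set \<Rightarrow> bool" where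
  "geodesic_segment X x y L \<longleftrightarrow>
     (\<exists>\<gamma>. geodesic X \<gamma> \<and> \<gamma> 0 = x \<and> \<gamma> 1 = y \<and> L = \<gamma> ` {0..1})"

definition geodesic_space :: "'a::metric_space set \<Rightarrow> bool" where
  "geodesic_space X \<longleftrightarrow> (\<forall>x\<in>X. \<forall>y\<in>X. \<exists>L. geodesic_segment X x y L)"

text \<open>
  A triangle is recorded by its vertices and its three sides, because the perimeter depends
  on the former and the Rips condition on the latter, not just on the union of the sides.
\<close>

definition geodesic_triangle ::
    "'a::metric_space set \<Rightarrow> 'a \<Rightarrow> 'a \<Rightarrow> 'a \<Rightarrow> 'a set \<Rightarrow> 'a set \<Rightarrow> 'a set \<Rightarrow> bool" where
  "geodesic_triangle X x y z A B C \<longleftrightarrow>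
     geodesic_segment X x y A \<and> geodesic_segment X y z B \<and> geodesic_segment X z x C"

definition perimeter :: "'a::metric_space \<Rightarrow> 'a \<Rightarrow> 'a \<Rightarrow> real" where
  "perimeter x y z = dist x y + dist y z + dist z x"

definition rips :: "'a::metric_space set \<Rightarrow> 'a set \<Rightarrow> 'a set \<Rightarrow> real \<Rightarrow> bool" where
  "rips A B C \<delta> \<longleftrightarrow>
     (\<forall>p\<in>A. infdist p (B \<union> C) \<le> \<delta>) \<and>
     (\<forall>p\<in>B. infdist p (C \<union> A) \<le> \<delta>) \<and>
     (\<forall>p\<in>C. infdist p (A \<union> B) \<le> \<delta>)"

definition delta_hyperbolic :: "'a::metric_space set \<Rightarrow> real \<Rightarrow> bool" where
  "delta_hyperbolic X \<delta> \<longleftrightarrow> geodesic_space X \<and>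
     (\<forall>x y z A B C. geodesic_triangle X x y z A B C \<longrightarrow> rips A B C \<delta>)"

definition hyperbolic :: "'a::metric_space set \<Rightarrow> bool" where
  "hyperbolic X \<longleftrightarrow> (\<exists>\<delta>\<ge>0. delta_hyperbolic X \<delta>)"

definition triangle_delta :: "'a::metric_space set \<Rightarrow> 'a set \<Rightarrow> 'a set \<Rightarrow> ereal" where
  "triangle_delta A B C = Inf {ereal \<delta> | \<delta>. rips A B C \<delta>}"

definition Omega :: "'a::metric_space set \<Rightarrow> real \<Rightarrow> ereal" where
  "Omega X t = Sup {triangle_delta A B C | x y z A B C.
     geodesic_triangle X x y z A B C \<and> perimeter x y z \<le> t}"

end

theory Submission
  imports Defs
begin

text \<open>
  If \<open>X\<close> is \<open>d\<close>-hyperbolic, then \<open>Omega X\<close> is bounded by \<open>d\<close> and \<open>Omega X t / t\<close> is eventually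
  at most \<open>1/64\<close>.

  Conversely, if the limit superior is below \<open>1/32\<close>, there is a threshold \<open>T > 0\<close> such that every
  triangle of perimeter at most \<open>u\<close>, where \<open>u \<ge> T\<close>, satisfies the Rips condition with constant
  \<open>u/32\<close>. It then follows that every triangle whatsoever satisfies the Rips condition with
  constant \<open>T\<close>. Suppose that the optimal constant \<open>D\<close> of some triangle exceeds \<open>T\<close>. By compactness
  it is attained: there are a side \<open>A = [x, y]\<close> and a point \<open>p\<close> of \<open>A\<close> at distance \<open>D\<close> from the union
  of the other two sides \<open>B = [y, z]\<close> and \<open>C = [x, z]\<close>, and every point of a side is within \<open>D\<close> of
  the other two. Around \<open>p\<close> a polygon of size comparable to \<open>D\<close> is cut out of the triangle. Its
  edges are the edge of \<open>A\<close> containing \<open>p\<close>, pieces of \<open>B\<close> and \<open>C\<close>, which are at distance at least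
  \<open>D\<close> from \<open>p\<close>, and cuts of length at most \<open>D\<close> joining the sides, chosen not too close to \<open>p\<close>.
  Triangulating the polygon and applying the Rips condition to one triangle after the other moves
  \<open>p\<close> to another edge of the polygon, by a distance at most the sum of the perimeters divided by
  \<open>32\<close>. That sum can be kept below \<open>32 * D\<close>, so that \<open>p\<close> is closer to that edge than possible.

  In more detail, cut \<open>A\<close> at distance \<open>5/4 * D\<close> on both sides of \<open>p\<close>, at \<open>x'\<close> and \<open>y'\<close>, with feet
  \<open>x''\<close> and \<open>y''\<close> on \<open>B \<union> C\<close> (\<open>cut_x\<close>). If both feet are on the same side, a quadrilateral gives the
  contradiction (\<open>same_side_imp_False\<close>); \<open>x''\<close> on \<open>B\<close> and \<open>y''\<close> on \<open>C\<close> is impossible by the triangle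
  inequality. Hence \<open>x''\<close> is on \<open>C\<close> and \<open>y''\<close> on \<open>B\<close>. By connectedness, some point between \<open>x'\<close> and
  \<open>y'\<close> is within \<open>D\<close> of both \<open>B\<close> and \<open>C\<close>, and again by a quadrilateral, \<open>p\<close> is within \<open>3/2 * D\<close> of
  \<open>C\<close>, up to exchanging \<open>x\<close> and \<open>y\<close> (\<open>close_to_C\<close>). Moving from there along \<open>C\<close> towards \<open>z\<close> leads to a
  third cut, between \<open>C\<close> and \<open>B\<close>, at distance \<open>51/20 * D\<close> from \<open>p\<close>, or to \<open>z\<close> itself if that is
  closer (\<open>close_to_C_imp_False\<close>), and the
  three cuts bound a hexagon, for which the sum of perimeters is at most \<open>31.3 * D\<close> (\<open>hexagon\<close>).
\<close>

section \<open>Geodesic segments\<close>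

lemma geodesic_segmentE:
  assumes "geodesic_segment X x y L"
  obtains \<gamma> where "geodesic X \<gamma>" "\<gamma> 0 = x" "\<gamma> 1 = y" "L = \<gamma> ` {0..1}"
    "\<And>t s. t \<in> {0..1} \<Longrightarrow> s \<in> {0..1} \<Longrightarrow> dist (\<gamma> t) (\<gamma> s) = dist x y * \<bar>t - s\<bar>"
proof -
  obtain \<gamma> where g: "geodesic X \<gamma>" "\<gamma> 0 = x" "\<gamma> 1 = y" "L = \<gamma> ` {0..1}"
    using assms unfolding geodesic_segment_def by blast
  obtain k where k: "\<And>t s. t \<in> {0..1} \<Longrightarrow> s \<in> {0..1} \<Longrightarrow> dist (\<gamma> t) (\<gamma> s) = k * \<bar>t - s\<bar>"
    using g(1) unfolding geodesic_def by blast
  have "k = dist x y" using k[of 0 1] g by simp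
  with k g that show ?thesis by blast
qed

lemma geodesic_segment_reverse:
  assumes "geodesic_segment X x y L"
  shows "geodesic_segment X y x L"
proof -
  obtain \<gamma> where g: "geodesic X \<gamma>" "\<gamma> 0 = x" "\<gamma> 1 = y" "L = \<gamma> ` {0..1}"
    and d: "\<And>t s. t \<in> {0..1} \<Longrightarrow> s \<in> {0..1} \<Longrightarrow> dist (\<gamma> t) (\<gamma> s) = dist x y * \<bar>t - s\<bar>"
    using geodesic_segmentE[OF assms] by metis
  define \<eta> where "\<eta> = (\<lambda>t. \<gamma> (1 - t))"
  have im: "\<eta> ` {0..1} = L"
  proof -
    have "(\<lambda>t::real. 1 - t) ` {0..1} = {0..1}" by simp
    moreover have "\<eta> ` {0..1} = \<gamma> ` ((\<lambda>t. 1 - t) ` {0..1})"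
      unfolding \<eta>_def by (simp only: image_image)
    ultimately show ?thesis using g(4) by simp
  qed
  have "geodesic X \<eta>" unfolding geodesic_def
  proof (intro conjI exI ballI)
    show "\<eta> ` {0..1} \<subseteq> X" using im g unfolding geodesic_def by simp
    fix t s :: real assume "t \<in> {0..1}" "s \<in> {0..1}"
    then show "dist (\<eta> t) (\<eta> s) = dist x y * \<bar>t - s\<bar>"
      using d[of "1 - t" "1 - s"] unfolding \<eta>_def by (simp add: abs_minus_commute)
  qed simp
  then show ?thesis unfolding geodesic_segment_def using im g
    by (intro exI[of _ \<eta>]) (auto simp: \<eta>_def)
qed

lemma geodesic_segment_subset:
  assumes "geodesic_segment X x y L" shows "L \<subseteq> X"
  using assms unfolding geodesic_segment_def geodesic_def by blast

lemma geodesic_segment_ends: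
  assumes "geodesic_segment X x y L" shows "x \<in> L" "y \<in> L"
  using assms unfolding geodesic_segment_def by force+

lemma geodesic_segment_compact_connected:
  assumes "geodesic_segment X x y L" shows "compact L" "connected L"
proof -
  obtain \<gamma> where g: "L = \<gamma> ` {0..1}"
    and d: "\<And>t s. t \<in> {0..1} \<Longrightarrow> s \<in> {0..1} \<Longrightarrow> dist (\<gamma> t) (\<gamma> s) = dist x y * \<bar>t - s\<bar>"
    using geodesic_segmentE[OF assms] by metis
  have "(dist x y)-lipschitz_on {0..1} \<gamma>"
    by (rule lipschitz_onI) (simp_all add: d dist_real_def)
  then have "continuous_on {0..1} \<gamma>" by (rule lipschitz_on_continuous_on)
  then show "compact L" "connected L"
    unfolding g by (auto intro: compact_continuous_image connected_continuous_image)
qed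

text \<open>A segment from \<open>x\<close> to \<open>y\<close> is an isometric copy of an interval, with coordinate
  the distance from \<open>x\<close>.\<close>

lemma geodesic_segment_dist:
  assumes "geodesic_segment X x y L" "u \<in> L" "v \<in> L"
  shows "dist u v = \<bar>dist x u - dist x v\<bar>"
proof -
  obtain \<gamma> where g: "\<gamma> 0 = x" "L = \<gamma> ` {0..1}"
    and d: "\<And>t s. t \<in> {0..1} \<Longrightarrow> s \<in> {0..1} \<Longrightarrow> dist (\<gamma> t) (\<gamma> s) = dist x y * \<bar>t - s\<bar>"
    using geodesic_segmentE[OF assms(1)] by metis
  obtain t s where ts: "t \<in> {0..1}" "s \<in> {0..1}" "u = \<gamma> t" "v = \<gamma> s"
    using assms g by blast
  have "dist x u = dist x y * t" "dist x v = dist x y * s"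
    using d[of 0 t] d[of 0 s] ts g by auto
  then have "\<bar>dist x u - dist x v\<bar> = \<bar>dist x y * (t - s)\<bar>" by (simp add: right_diff_distrib)
  also have "\<dots> = dist u v" using d[OF ts(1,2)] ts by (simp add: abs_mult)
  finally show ?thesis by simp
qed

lemma geodesic_segment_between:
  assumes "geodesic_segment X x y L" "u \<in> L"
  shows "dist x u + dist u y = dist x y"
proof -
  obtain \<gamma> where g: "\<gamma> 0 = x" "\<gamma> 1 = y" "L = \<gamma> ` {0..1}"
    and d: "\<And>t s. t \<in> {0..1} \<Longrightarrow> s \<in> {0..1} \<Longrightarrow> dist (\<gamma> t) (\<gamma> s) = dist x y * \<bar>t - s\<bar>"
    using geodesic_segmentE[OF assms(1)] by metis
  obtain t where t: "t \<in> {0..1}" "u = \<gamma> t" using assms g by blast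
  have "dist x u = dist x y * t" "dist u y = dist x y * (1 - t)"
    using d[of 0 t] d[of t 1] t g by auto
  then show ?thesis by (simp add: algebra_simps)
qed

lemma geodesic_segment_point:
  assumes "geodesic_segment X x y L" "0 \<le> \<tau>" "\<tau> \<le> dist x y"
  obtains u where "u \<in> L" "dist x u = \<tau>"
proof (cases "x = y")
  case True
  then show ?thesis using that[of x] assms geodesic_segment_ends[OF assms(1)] by simp
next
  case False
  obtain \<gamma> where g: "\<gamma> 0 = x" "L = \<gamma> ` {0..1}"
    and d: "\<And>t s. t \<in> {0..1} \<Longrightarrow> s \<in> {0..1} \<Longrightarrow> dist (\<gamma> t) (\<gamma> s) = dist x y * \<bar>t - s\<bar>"
    using geodesic_segmentE[OF assms(1)] by metis
  have t: "\<tau> / dist x y \<in> {0..1}" using False assms by simp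
  show ?thesis
  proof (rule that[of "\<gamma> (\<tau> / dist x y)"])
    show "\<gamma> (\<tau> / dist x y) \<in> L" using t g by blast
    show "dist x (\<gamma> (\<tau> / dist x y)) = \<tau>" using d[of 0, OF _ t] g False assms by simp
  qed
qed

lemma geodesic_subsegment_ordered:
  assumes L: "geodesic_segment X x y L" and ab: "a \<in> L" "b \<in> L" "dist x a \<le> dist x b"
  obtains M where "geodesic_segment X a b M" "M \<subseteq> L"
    "\<And>p. p \<in> L \<Longrightarrow> dist x a \<le> dist x p \<Longrightarrow> dist x p \<le> dist x b \<Longrightarrow> p \<in> M"
proof -
  obtain \<gamma> where g: "geodesic X \<gamma>" "\<gamma> 0 = x" "\<gamma> 1 = y" "L = \<gamma> ` {0..1}"
    and d: "\<And>t s. t \<in> {0..1} \<Longrightarrow> s \<in> {0..1} \<Longrightarrow> dist (\<gamma> t) (\<gamma> s) = dist x y * \<bar>t - s\<bar>"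
    using geodesic_segmentE[OF L] by metis
  show ?thesis
  proof (cases "x = y")
    case True
    have triv: "u = x" if "u \<in> L" for u
      using geodesic_segment_between[OF L that] True
      by (smt (verit) dist_commute dist_eq_0_iff zero_le_dist)
    have "L = {x}" using triv geodesic_segment_ends[OF L] by blast
    then show ?thesis using that[of L] L ab True by auto
  next
    case False
    then have k: "dist x y > 0" by simp
    obtain t where t: "t \<in> {0..1}" "a = \<gamma> t" using ab g by blast
    obtain s where s: "s \<in> {0..1}" "b = \<gamma> s" using ab g by blast
    have da: "dist x (\<gamma> r) = dist x y * r" if "r \<in> {0..1}" for r
      using d[of 0 r] that g by simp
    have ts: "t \<le> s" using ab(3) da[OF t(1)] da[OF s(1)] t s k by simp
    define \<eta> where "\<eta> = (\<lambda>r. \<gamma> (t + r * (s - t)))"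
    have in01: "t + r * (s - t) \<in> {t..s}" if "r \<in> {0..1}" for r
      using that ts mult_left_le_one_le[of "s - t" r] by simp
    have sub: "{t..s} \<subseteq> {0..1}" using t s by auto
    have im: "\<eta> ` {0..1} = \<gamma> ` {t..s}"
    proof
      show "\<eta> ` {0..1} \<subseteq> \<gamma> ` {t..s}" unfolding \<eta>_def using in01 by blast
      show "\<gamma> ` {t..s} \<subseteq> \<eta> ` {0..1}"
      proof
        fix q assume "q \<in> \<gamma> ` {t..s}"
        then obtain r where r: "r \<in> {t..s}" "q = \<gamma> r" by blast
        show "q \<in> \<eta> ` {0..1}"
        proof (cases "t = s")
          case True
          then have "q = \<eta> 0" using r unfolding \<eta>_def by simp
          then show ?thesis by simp
        next
          case False
          with ts have "s - t > 0" by simp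
          then have "(r - t) / (s - t) \<in> {0..1}" "q = \<eta> ((r - t) / (s - t))"
            using r unfolding \<eta>_def by auto
          then show ?thesis by blast
        qed
      qed
    qed
    have "geodesic X \<eta>" unfolding geodesic_def
    proof (intro conjI exI ballI)
      show "\<eta> ` {0..1} \<subseteq> X" using im sub g(1) unfolding geodesic_def by blast
      show "0 \<le> dist x y * (s - t)" using ts by simp
      fix r r' :: real assume r: "r \<in> {0..1}" "r' \<in> {0..1}"
      have "dist (\<eta> r) (\<eta> r') = dist x y * \<bar>(t + r * (s - t)) - (t + r' * (s - t))\<bar>"
        unfolding \<eta>_def using d in01[OF r(1)] in01[OF r(2)] sub by blast
      also have "\<bar>(t + r * (s - t)) - (t + r' * (s - t))\<bar> = \<bar>(s - t) * (r - r')\<bar>"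
        by (simp add: algebra_simps)
      also have "\<dots> = (s - t) * \<bar>r - r'\<bar>" using ts by (simp add: abs_mult)
      finally show "dist (\<eta> r) (\<eta> r') = dist x y * (s - t) * \<bar>r - r'\<bar>" by simp
    qed
    then have "geodesic_segment X a b (\<gamma> ` {t..s})"
      unfolding geodesic_segment_def using im t s
      by (intro exI[of _ \<eta>]) (auto simp: \<eta>_def)
    moreover have "\<gamma> ` {t..s} \<subseteq> L" using sub g by blast
    moreover have "p \<in> \<gamma> ` {t..s}"
      if p: "p \<in> L" "dist x a \<le> dist x p" "dist x p \<le> dist x b" for p
    proof -
      obtain r where r: "r \<in> {0..1}" "p = \<gamma> r" using p g by blast
      have "t \<le> r" "r \<le> s" using p da[OF r(1)] da[OF t(1)] da[OF s(1)] r t s k by auto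
      then show ?thesis using r by simp
    qed
    ultimately show ?thesis by (rule that)
  qed
qed

lemma geodesic_subsegment_through:
  assumes "geodesic_segment X x y L" "a \<in> L" "p \<in> L" "b \<in> L"
    and "dist x a \<le> dist x p" "dist x p \<le> dist x b"
  obtains M where "geodesic_segment X a b M" "p \<in> M"
proof -
  have "dist x a \<le> dist x b" using assms(5,6) by simp
  then show ?thesis
    by (rule geodesic_subsegment_ordered[OF assms(1,2,4)]) (use that assms in blast)
qed

lemma geodesic_subsegment:
  assumes L: "geodesic_segment X x y L" and ab: "a \<in> L" "b \<in> L"
  obtains M where "geodesic_segment X a b M" "M \<subseteq> L"
proof (cases "dist x a \<le> dist x b")
  case True
  show ?thesis by (rule geodesic_subsegment_ordered[OF L ab True]) (rule that)
next
  case False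
  then have "dist x b \<le> dist x a" by simp
  then show ?thesis
    by (rule geodesic_subsegment_ordered[OF L ab(2,1)]) (rule that[OF geodesic_segment_reverse])
qed

text \<open>A point of a short segment from \<open>a\<close> to \<open>b\<close> is not much closer to \<open>p\<close> than the endpoints are
  on average.\<close>

lemma geodesic_segment_far:
  assumes "geodesic_segment X a b L" "v \<in> L"
  shows "dist p a + dist p b \<le> 2 * dist p v + dist a b"
  using geodesic_segment_between[OF assms] dist_triangle[of p a v] dist_triangle[of p b v]
  by (simp add: dist_commute)

lemma compact_infdist_le:
  assumes "compact S" "S \<noteq> {}" "infdist p S \<le> r"
  obtains q where "q \<in> S" "dist p q \<le> r"
proof -
  obtain q where q: "q \<in> S" "\<forall>q'\<in>S. dist p q \<le> dist p q'"
    using continuous_attains_inf[OF assms(1,2) continuous_on_dist[OF continuous_on_const continuous_on_id]]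
    by blast
  have "dist p q \<le> infdist p S"
    unfolding infdist_notempty[OF assms(2)] by (rule cINF_greatest) (use assms(2) q in auto)
  then have "dist p q \<le> r" using assms(3) by simp
  then show ?thesis using that q(1) by blast
qed


section \<open>Chains of small triangles\<close>

text \<open>Triangles of perimeter at most \<open>u\<close> satisfy the Rips condition with constant \<open>u / 32\<close>,
  provided that \<open>u\<close> is at least the threshold \<open>T\<close>.\<close>

locale thin_space =
  fixes X :: "'a::metric_space set" and T :: real
  assumes space: "geodesic_space X"
    and thin: "\<And>u x y z A B C. T \<le> u \<Longrightarrow> geodesic_triangle X x y z A B C \<Longrightarrow>
      perimeter x y z \<le> u \<Longrightarrow> rips A B C (u / 32)"
begin

text \<open>One step of a chain: \<open>p\<close> moves from one side of a triangle to one of the other two.\<close>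

lemma triangle_step:
  assumes L: "geodesic_segment X a b L" "p \<in> L"
    and M: "geodesic_segment X b c M" and N: "geodesic_segment X a c N"
    and u: "dist a b + dist b c + dist a c \<le> u" "T \<le> u"
  shows "(\<exists>q\<in>M. dist p q \<le> u / 32) \<or> (\<exists>q\<in>N. dist p q \<le> u / 32)"
proof -
  have "geodesic_triangle X a b c L M N"
    unfolding geodesic_triangle_def using L M geodesic_segment_reverse[OF N] by blast
  then have "rips L M N (u / 32)"
    using thin u by (simp add: perimeter_def dist_commute)
  then have "infdist p (M \<union> N) \<le> u / 32" using L(2) unfolding rips_def by blast
  moreover have "compact (M \<union> N)" "M \<union> N \<noteq> {}"
    using M N geodesic_segment_compact_connected geodesic_segment_ends by (blast intro: compact_Un)+
  ultimately show ?thesis using compact_infdist_le by (metis Un_iff)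
qed

lemma segment_exists:
  assumes "a \<in> X" "b \<in> X"
  obtains L where "geodesic_segment X a b L"
  using space assms unfolding geodesic_space_def by blast

text \<open>A chain of two steps in the quadrilateral with vertices \<open>a, b, b', a'\<close>. The diagonal from \<open>b\<close> to
  \<open>a'\<close> is chosen so that the edge \<open>P\<close> is met in the first step, with a better bound.\<close>

lemma quadrilateral_step:
  assumes L: "geodesic_segment X a b L" "p \<in> L"
    and P: "geodesic_segment X a a' P" and Q: "geodesic_segment X b b' Q"
    and S: "geodesic_segment X a' b' S"
    and d: "dist a b \<le> l" "dist a a' \<le> D" "dist b b' \<le> D" "T \<le> D" "0 \<le> D"
  shows "(\<exists>v\<in>P. dist p v \<le> (2 * l + 2 * D) / 32) \<or> (\<exists>v\<in>Q. dist p v \<le> (4 * l + 6 * D) / 32)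
    \<or> (\<exists>v\<in>S. dist p v \<le> (4 * l + 6 * D) / 32)"
proof -
  have X: "a' \<in> X" "b \<in> X"
    using P L geodesic_segment_subset geodesic_segment_ends by blast+
  obtain E where E: "geodesic_segment X b a' E" using segment_exists[OF X(2,1)] .
  have l0: "0 \<le> l" using d(1) zero_le_dist[of a b] by linarith
  have ba': "dist b a' \<le> l + D"
    using d dist_triangle[of b a' a] by (simp add: dist_commute)
  have a'b': "dist a' b' \<le> l + 2 * D"
    using d ba' dist_triangle[of a' b' b] by (simp add: dist_commute)
  have "(\<exists>q\<in>E. dist p q \<le> (2 * l + 2 * D) / 32) \<or> (\<exists>q\<in>P. dist p q \<le> (2 * l + 2 * D) / 32)"
    by (rule triangle_step[OF L E P]) (use d ba' l0 in linarith)+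
  then show ?thesis
  proof
    assume "\<exists>q\<in>E. dist p q \<le> (2 * l + 2 * D) / 32"
    then obtain q where q: "q \<in> E" "dist p q \<le> (2 * l + 2 * D) / 32" by blast
    have "(\<exists>v\<in>S. dist q v \<le> (2 * l + 4 * D) / 32) \<or> (\<exists>v\<in>Q. dist q v \<le> (2 * l + 4 * D) / 32)"
      by (rule triangle_step[OF E q(1) S Q]) (use d ba' a'b' l0 in linarith)+
    then obtain v where v: "v \<in> S \<or> v \<in> Q" "dist q v \<le> (2 * l + 4 * D) / 32" by blast
    have "dist p v \<le> (4 * l + 6 * D) / 32"
      using q(2) v(2) dist_triangle[of p v q] by simp
    with v(1) show ?thesis by blast
  qed blast
qed

end


section \<open>A triangle much fatter than the threshold\<close>

text \<open>A cut of the side \<open>A\<close> next to its point \<open>p\<close>: a point \<open>a\<close> of \<open>A\<close> and a foot \<open>b\<close> close to it, such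
  that no geodesic from \<open>a\<close> to \<open>b\<close> comes too close to \<open>p\<close>.\<close>

definition cut :: "'a::metric_space set \<Rightarrow> 'a set \<Rightarrow> 'a \<Rightarrow> real \<Rightarrow> 'a \<Rightarrow> 'a \<Rightarrow> bool" where
  "cut X A p D a b \<longleftrightarrow> a \<in> A \<and> dist p a \<le> 5/4 * D \<and> dist a b \<le> D \<and>
     (\<forall>P v. geodesic_segment X a b P \<longrightarrow> v \<in> P \<longrightarrow> 5/8 * D \<le> dist p v)"

lemma cutD:
  assumes "cut X A p D a b"
  shows "a \<in> A" "dist p a \<le> 5/4 * D" "dist a b \<le> D"
    and "\<And>P v. geodesic_segment X a b P \<Longrightarrow> v \<in> P \<Longrightarrow> 5/8 * D \<le> dist p v"
  using assms unfolding cut_def by blast+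

text \<open>The sides \<open>B\<close> and \<open>C\<close> meet in \<open>z\<close>, and the point \<open>p\<close> of the side \<open>A\<close> realises the
  optimal Rips constant \<open>D\<close> of the triangle. Unlike in a \<open>geodesic_triangle\<close>, the side \<open>C\<close> is
  oriented from \<open>x\<close> to \<open>z\<close>, so that the configuration is symmetric in \<open>x\<close> and \<open>y\<close>.\<close>

locale fat_triangle = thin_space X T for X :: "'a::metric_space set" and T :: real +
  fixes x y z :: 'a and A B C :: "'a set" and p :: 'a and D :: real
  assumes A: "geodesic_segment X x y A" and B: "geodesic_segment X y z B"
    and C: "geodesic_segment X x z C"
    and D: "0 < D" "T \<le> D"
    and pA: "p \<in> A"
    and far: "\<And>q. q \<in> B \<union> C \<Longrightarrow> D \<le> dist p q"
    and nearA: "\<And>a. a \<in> A \<Longrightarrow> \<exists>q\<in>B \<union> C. dist a q \<le> D"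
    and nearB: "\<And>b. b \<in> B \<Longrightarrow> \<exists>q\<in>A \<union> C. dist b q \<le> D"
    and nearC: "\<And>c. c \<in> C \<Longrightarrow> \<exists>q\<in>A \<union> B. dist c q \<le> D"
begin

lemma swap: "fat_triangle X T y x z A C B p D"
proof unfold_locales
  show "geodesic_segment X y x A" using geodesic_segment_reverse[OF A] .
qed (use A B C D pA far nearA nearB nearC in \<open>auto simp: Un_commute\<close>)

lemma subsets: "A \<subseteq> X" "B \<subseteq> X" "C \<subseteq> X"
  using A B C geodesic_segment_subset by blast+

text \<open>There is a cut on the side of \<open>x\<close>. If \<open>x\<close> itself is close to \<open>p\<close>, it is taken to be \<open>(x, x)\<close>,
  with foot in \<open>C\<close>.\<close>

lemma cut_x:
  obtains x' x'' where "cut X A p D x' x''" "dist x x' \<le> dist x p" "x'' \<in> B \<union> C"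
    "x'' \<in> C \<or> dist p x' = 5/4 * D"
proof (cases "dist x p \<le> 5/4 * D")
  case True
  have x: "x \<in> A" "x \<in> C" using A C geodesic_segment_ends by blast+
  have "5/8 * D \<le> dist p v" if "geodesic_segment X x x P" "v \<in> P" for P v
    using geodesic_segment_far[OF that, of p] far[of x] x D by simp
  then have "cut X A p D x x" unfolding cut_def using x True D by (auto simp: dist_commute)
  then show ?thesis by (rule that) (use x in auto)
next
  case False
  have "dist x p \<le> dist x y"
    using geodesic_segment_between[OF A pA] zero_le_dist[of p y] by linarith
  then obtain x' where x': "x' \<in> A" "dist x x' = dist x p - 5/4 * D"
    using geodesic_segment_point[OF A, of "dist x p - 5/4 * D"] False D by auto
  have px': "dist p x' = 5/4 * D" using geodesic_segment_dist[OF A pA x'(1)] x'(2) D by simp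
  obtain x'' where x'': "x'' \<in> B \<union> C" "dist x' x'' \<le> D" using nearA[OF x'(1)] by blast
  have "5/8 * D \<le> dist p v" if "geodesic_segment X x' x'' P" "v \<in> P" for P v
    using geodesic_segment_far[OF that, of p] px' x''(2) far[OF x''(1)] by linarith
  then have "cut X A p D x' x''" unfolding cut_def using x' px' x'' by auto
  then show ?thesis by (rule that) (use x' x'' px' D in auto)
qed

text \<open>The hexagon with vertices \<open>x', y', y'', q'', q', x''\<close>, with edges along \<open>C\<close> from \<open>x''\<close> to
  \<open>q'\<close> and along \<open>B\<close> from \<open>y''\<close> to \<open>q''\<close>. It is triangulated
  by the diagonals from \<open>q'\<close> to \<open>x'\<close>, \<open>y'\<close> and \<open>y''\<close>. The edges from \<open>x'\<close> to \<open>x''\<close> and from \<open>y'\<close>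
  to \<open>y''\<close> are met after two steps, when \<open>p\<close> has moved by at most \<open>19.7/32 * D\<close>, which is less
  than \<open>5/8 * D\<close>.\<close>

lemma hexagon:
  assumes M: "geodesic_segment X x' y' M" "p \<in> M"
    and cutx: "cut X A p D x' x''" "x'' \<in> C"
    and cuty: "cut X A p D y' y''" "y'' \<in> B"
    and q: "q' \<in> C" "q'' \<in> B" "dist q' q'' \<le> D" "dist p q' \<le> 51/20 * D"
    and q_far: "\<forall>P v. geodesic_segment X q' q'' P \<longrightarrow> v \<in> P \<longrightarrow> D \<le> dist p v"
  shows False
proof -
  note x' = cutD(2)[OF cutx(1)] cutx(2) cutD(3)[OF cutx(1)]
    and y' = cutD(2)[OF cuty(1)] cuty(2) cutD(3)[OF cuty(1)]
    and x'_far = cutD(4)[OF cutx(1)] and y'_far = cutD(4)[OF cuty(1)]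
  have X: "x' \<in> X" "y' \<in> X" "x'' \<in> X" "y'' \<in> X" "q' \<in> X" "q'' \<in> X"
    using cutD(1)[OF cutx(1)] cutD(1)[OF cuty(1)] subsets x' y' q by auto
  obtain E where E: "geodesic_segment X y' q' E" using segment_exists X by blast
  obtain F where F: "geodesic_segment X x' q' F" using segment_exists X by blast
  obtain G where G: "geodesic_segment X q' y'' G" using segment_exists X by blast
  obtain P where P: "geodesic_segment X x' x'' P" using segment_exists X by blast
  obtain Q where Q: "geodesic_segment X y' y'' Q" using segment_exists X by blast
  obtain R where R: "geodesic_segment X q' q'' R" using segment_exists X by blast
  obtain S where S: "geodesic_segment X q' x'' S" "S \<subseteq> C"
    using geodesic_subsegment[OF C q(1) x'(2)] .
  obtain U where U: "geodesic_segment X y'' q'' U" "U \<subseteq> B"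
    using geodesic_subsegment[OF B y'(2) q(2)] .
  have d1: "dist x' y' \<le> 5/2 * D"
    using x' y' dist_triangle[of x' y' p] by (simp add: dist_commute)
  have d2: "dist x' q' \<le> 19/5 * D" "dist y' q' \<le> 19/5 * D"
    using x' y' q dist_triangle[of x' q' p] dist_triangle[of y' q' p] by (auto simp: dist_commute)
  have d3: "dist q' x'' \<le> 24/5 * D" "dist q' y'' \<le> 24/5 * D"
    using x' y' d2 dist_triangle[of q' x'' x'] dist_triangle[of q' y'' y']
    by (auto simp: dist_commute)
  have d4: "dist y'' q'' \<le> 29/5 * D"
    using d3 q dist_triangle[of y'' q'' q'] by (auto simp: dist_commute)
  have "(\<exists>q\<in>E. dist p q \<le> (101/10 * D) / 32) \<or> (\<exists>q\<in>F. dist p q \<le> (101/10 * D) / 32)"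
    by (rule triangle_step[OF M E F]) (use d1 d2 D in linarith)+
  then show False
  proof
    assume "\<exists>q\<in>F. dist p q \<le> (101/10 * D) / 32"
    then obtain v where v: "v \<in> F" "dist p v \<le> (101/10 * D) / 32" by blast
    have "(\<exists>q\<in>S. dist v q \<le> (48/5 * D) / 32) \<or> (\<exists>q\<in>P. dist v q \<le> (48/5 * D) / 32)"
      by (rule triangle_step[OF F v(1) S(1) P]) (use d2 d3 x' D in linarith)+
    then obtain w where w: "w \<in> S \<or> w \<in> P" "dist v w \<le> (48/5 * D) / 32" by blast
    have pw: "dist p w < 5/8 * D" using v(2) w(2) D dist_triangle[of p w v] by simp
    have "D \<le> dist p w" if "w \<in> S" using that S(2) far by blast
    then show False using w(1) x'_far[OF P, of w] pw D by auto
  next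
    assume "\<exists>q\<in>E. dist p q \<le> (101/10 * D) / 32"
    then obtain v where v: "v \<in> E" "dist p v \<le> (101/10 * D) / 32" by blast
    have "(\<exists>q\<in>G. dist v q \<le> (48/5 * D) / 32) \<or> (\<exists>q\<in>Q. dist v q \<le> (48/5 * D) / 32)"
      by (rule triangle_step[OF E v(1) G Q]) (use d2 d3 y' D in linarith)+
    then obtain w where w: "w \<in> G \<or> w \<in> Q" "dist v w \<le> (48/5 * D) / 32" by blast
    have pw: "dist p w \<le> (197/10 * D) / 32" using v(2) w(2) dist_triangle[of p w v] by simp
    then have "w \<notin> Q" using y'_far[OF Q, of w] D by auto
    with w have wG: "w \<in> G" by blast
    have "(\<exists>q\<in>U. dist w q \<le> (58/5 * D) / 32) \<or> (\<exists>q\<in>R. dist w q \<le> (58/5 * D) / 32)"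
      by (rule triangle_step[OF G wG U(1) R]) (use d3 d4 q D in linarith)+
    then obtain r where r: "r \<in> U \<or> r \<in> R" "dist w r \<le> (58/5 * D) / 32" by blast
    have "dist p r < D" using pw r(2) D dist_triangle[of p r w] by simp
    moreover have "D \<le> dist p r" using r(1) q_far R far U(2) by blast
    ultimately show False by simp
  qed
qed

text \<open>Once \<open>p\<close> is cut off on both sides, with feet on different sides of the triangle, and is close
  to \<open>C\<close>, a third cut towards the vertex \<open>z\<close> closes the hexagon. The value \<open>51/20\<close> has to exceed \<open>5/2\<close>
  in order to exclude that \<open>C\<close> returns to the part of \<open>A\<close> between \<open>x\<close> and \<open>p\<close>, and to be small enough
  for the bounds of the hexagon.\<close>

lemma close_to_C_imp_False:
  assumes cutx: "cut X A p D x' x''" "dist x x' \<le> dist x p" "x'' \<in> C"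
    and cuty: "cut X A p D y' y''" "dist y y' \<le> dist y p" "y'' \<in> B"
    and c: "c \<in> C" "dist p c \<le> 3/2 * D"
  shows False
proof -
  note x' = cutD(1)[OF cutx(1)] cutx(2) cutD(2)[OF cutx(1)] cutx(3) cutD(3)[OF cutx(1)]
    and y' = cutD(1)[OF cuty(1)] cuty(2) cutD(2)[OF cuty(1)] cuty(3) cutD(3)[OF cuty(1)]
    and x'_far = cutD(4)[OF cutx(1)]
  have py': "dist x p \<le> dist x y'"
    using y' geodesic_segment_between[OF A pA] geodesic_segment_between[OF A y'(1)]
    by (simp add: dist_commute)
  then obtain M where M: "geodesic_segment X x' y' M" "p \<in> M"
    using geodesic_subsegment_through[OF A x'(1) pA y'(1) x'(2)] by blast
  note hex = hexagon[OF M cutx(1,3) cuty(1,3)]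
  have z: "z \<in> B" "z \<in> C" using B C geodesic_segment_ends by blast+
  show False
  proof (cases "dist p z \<le> 51/20 * D")
    case True
    have "D \<le> dist p v" if "geodesic_segment X z z P" "v \<in> P" for P v
      using geodesic_segment_far[OF that, of p] far[of z] z by simp
    then show False using hex[OF z(2,1)] True D by simp
  next
    case False
    obtain N where N: "geodesic_segment X c z N" "N \<subseteq> C"
      using geodesic_subsegment[OF C c(1) z(2)] .
    have "connected (dist p ` N)"
      by (intro connected_continuous_image continuous_intros geodesic_segment_compact_connected[OF N(1)])
    moreover have "dist p c \<in> dist p ` N" "dist p z \<in> dist p ` N"
      using geodesic_segment_ends[OF N(1)] by blast+
    ultimately have "51/20 * D \<in> dist p ` N"
      by (rule connectedD_interval) (use c False D in linarith)+
    then obtain q' where q': "q' \<in> N" "dist p q' = 51/20 * D" by auto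
    have q'C: "q' \<in> C" using q' N by blast
    show False
    proof (cases "\<exists>q''\<in>B. dist q' q'' \<le> D")
      case True
      then obtain q'' where q'': "q'' \<in> B" "dist q' q'' \<le> D" by blast
      have "D \<le> dist p v" if P: "geodesic_segment X q' q'' P" "v \<in> P" for P v
      proof -
        have "dist q' v \<le> D"
          using geodesic_segment_between[OF P] q''(2) zero_le_dist[of v q''] by linarith
        then show ?thesis using q'(2) D dist_triangle[of p q' v] by (simp add: dist_commute)
      qed
      then show False using hex[OF q'C q''] q'(2) by simp
    next
      case no: False
      then obtain u where u: "u \<in> A" "dist q' u \<le> D" using nearC[OF q'C] by blast
      have pu: "31/20 * D \<le> dist p u" "dist p u \<le> 71/20 * D"
        using u q'(2) dist_triangle[of p q' u] dist_triangle[of p u q'] by (auto simp: dist_commute)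
      show False
      proof (cases "dist x p \<le> dist x u")
        case True
        \<comment> \<open>Here \<open>p\<close> lies between \<open>x'\<close> and \<open>u\<close>, which both have feet on \<open>C\<close>.\<close>
        then obtain L where L: "geodesic_segment X x' u L" "p \<in> L"
          using geodesic_subsegment_through[OF A x'(1) pA u(1) x'(2)] by blast
        have X: "x' \<in> X" "x'' \<in> X" "u \<in> X" "q' \<in> X" using x' u q'C subsets by blast+
        obtain P where P: "geodesic_segment X x' x'' P" using segment_exists X by blast
        obtain Q where Q: "geodesic_segment X u q' Q" using segment_exists X by blast
        obtain S where S: "geodesic_segment X x'' q' S" "S \<subseteq> C"
          using geodesic_subsegment[OF C x'(4) q'C] .
        have l: "dist x' u \<le> 24/5 * D"
          using x'(3) pu dist_triangle[of x' u p] by (simp add: dist_commute)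
        have uq: "dist u q' \<le> D" "0 \<le> D" using u D by (auto simp: dist_commute)
        have "D \<le> dist p v" if "v \<in> Q" for v
          using geodesic_segment_far[OF Q that, of p] pu q'(2) uq D by linarith
        moreover have "D \<le> dist p v" if "v \<in> S" for v using that S far by blast
        moreover have "(2 * (24/5 * D) + 2 * D) / 32 < 5/8 * D" "(4 * (24/5 * D) + 6 * D) / 32 < D"
          using D by simp_all
        ultimately show False
          using quadrilateral_step[OF L P Q S(1) l x'(5) uq(1) D(2) uq(2)] x'_far[OF P]
          by (meson not_less order_trans)
      next
        case xu: False
        \<comment> \<open>Towards \<open>z\<close> the side \<open>C\<close> moves away from \<open>x\<close>, so it cannot return to the part of \<open>A\<close>
          between \<open>x\<close> and \<open>p\<close>.\<close>
        have "dist x u = dist x p - dist p u"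
          using geodesic_segment_dist[OF A pA u(1)] xu by simp
        then have 1: "dist x q' \<le> dist x p - 11/20 * D"
          using dist_triangle[of x q' u] u(2) pu by (simp add: dist_commute)
        have "dist x q' = dist x c + dist c q'"
          using geodesic_segment_between[OF C q'C] geodesic_segment_between[OF C c(1)]
            geodesic_segment_between[OF N(1) q'(1)] by linarith
        moreover have "dist x p \<le> dist x c + 3/2 * D"
          using dist_triangle[of x p c] c by (simp add: dist_commute)
        moreover have "51/20 * D \<le> 3/2 * D + dist c q'"
          using dist_triangle[of p q' c] c q'(2) by simp
        ultimately show False using 1 D by linarith
      qed
    qed
  qed
qed

lemma same_side_imp_False:
  assumes cutx: "cut X A p D x' x''" "dist x x' \<le> dist x p"
    and cuty: "cut X A p D y' y''" "dist y y' \<le> dist y p"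
    and S: "geodesic_segment X x'' y'' S" "S \<subseteq> B \<union> C"
  shows False
proof -
  note x' = cutD(1)[OF cutx(1)] cutx(2) cutD(2,3)[OF cutx(1)]
    and y' = cutD(1)[OF cuty(1)] cuty(2) cutD(2,3)[OF cuty(1)]
    and x'_far = cutD(4)[OF cutx(1)] and y'_far = cutD(4)[OF cuty(1)]
  have py': "dist x p \<le> dist x y'"
    using y' geodesic_segment_between[OF A pA] geodesic_segment_between[OF A y'(1)]
    by (simp add: dist_commute)
  then obtain M where M: "geodesic_segment X x' y' M" "p \<in> M"
    using geodesic_subsegment_through[OF A x'(1) pA y'(1) x'(2)] by blast
  have X: "x' \<in> X" "x'' \<in> X" "y' \<in> X" "y'' \<in> X"
    using x' y' subsets geodesic_segment_subset[OF S(1)] geodesic_segment_ends[OF S(1)] by blast+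
  obtain P where P: "geodesic_segment X x' x'' P" using segment_exists X by blast
  obtain Q where Q: "geodesic_segment X y' y'' Q" using segment_exists X by blast
  have l: "dist x' y' \<le> 5/2 * D"
    using x' y' dist_triangle[of x' y' p] by (simp add: dist_commute)
  have D0: "0 \<le> D" using D by simp
  have "D \<le> dist p v" if "v \<in> S" for v using that S far by blast
  moreover have "(2 * (5/2 * D) + 2 * D) / 32 < 5/8 * D" "(4 * (5/2 * D) + 6 * D) / 32 < 5/8 * D"
      "(4 * (5/2 * D) + 6 * D) / 32 < D"
    using D by simp_all
  ultimately show False
    using quadrilateral_step[OF M P Q S(1) l x'(4) y'(4) D(2) D0] x'_far[OF P] y'_far[OF Q]
    by (meson not_less order_trans)
qed

text \<open>The part of \<open>A\<close> between \<open>x'\<close> and a point \<open>u\<close> close to \<open>C\<close> bounds a quadrilateral with \<open>C\<close>;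
  if it contains \<open>p\<close>, then \<open>p\<close> can only be close to the edge from \<open>u\<close> to \<open>C\<close>.\<close>

lemma close_to_C:
  assumes cutx: "cut X A p D x' x''" "dist x x' \<le> dist x p" "x'' \<in> C"
    and u: "u \<in> A" "dist x p \<le> dist x u" "dist p u \<le> 5/4 * D" "c \<in> C" "dist u c \<le> D"
  shows "dist p c \<le> 3/2 * D"
proof -
  note x' = cutD(1)[OF cutx(1)] cutx(2) cutD(2)[OF cutx(1)] cutx(3) cutD(3)[OF cutx(1)]
    and x'_far = cutD(4)[OF cutx(1)]
  obtain M where M: "geodesic_segment X x' u M" "p \<in> M"
    using geodesic_subsegment_through[OF A x'(1) pA u(1) x'(2) u(2)] .
  have X: "x' \<in> X" "x'' \<in> X" "u \<in> X" "c \<in> X" using x' u subsets by blast+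
  obtain P where P: "geodesic_segment X x' x'' P" using segment_exists X by blast
  obtain Q where Q: "geodesic_segment X u c Q" using segment_exists X by blast
  obtain S where S: "geodesic_segment X x'' c S" "S \<subseteq> C"
    using geodesic_subsegment[OF C x'(4) u(4)] .
  have l: "dist x' u \<le> 5/2 * D"
    using x' u dist_triangle[of x' u p] by (simp add: dist_commute)
  have D0: "0 \<le> D" using D by simp
  have "D \<le> dist p v" if "v \<in> S" for v using that S far by blast
  moreover have "(2 * (5/2 * D) + 2 * D) / 32 < 5/8 * D" "(4 * (5/2 * D) + 6 * D) / 32 < D"
    using D by simp_all
  ultimately obtain v where v: "v \<in> Q" "dist p v \<le> (4 * (5/2 * D) + 6 * D) / 32"
    using quadrilateral_step[OF M P Q S(1) l x'(5) u(5) D(2) D0] x'_far[OF P]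
    by (meson not_less order_trans)
  have "dist v c \<le> D"
    using geodesic_segment_between[OF Q v(1)] u(5) zero_le_dist[of u v] by linarith
  then show ?thesis using v(2) dist_triangle[of p c v] by simp
qed

lemma contradiction: False
proof -
  interpret s: fat_triangle X T y x z A C B p D by (rule swap)
  obtain x' x'' where cutx: "cut X A p D x' x''" "dist x x' \<le> dist x p"
      and footx: "x'' \<in> B \<union> C" "x'' \<in> C \<or> dist p x' = 5/4 * D"
    using cut_x .
  obtain y' y'' where cuty: "cut X A p D y' y''" "dist y y' \<le> dist y p"
      and footy: "y'' \<in> C \<union> B" "y'' \<in> B \<or> dist p y' = 5/4 * D"
    using s.cut_x .
  note x' = cutD(1)[OF cutx(1)] cutx(2) cutD(2)[OF cutx(1)] footx(1) cutD(3)[OF cutx(1)] footx(2)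
    and y' = cutD(1)[OF cuty(1)] cuty(2) cutD(2)[OF cuty(1)] footy(1) cutD(3)[OF cuty(1)] footy(2)
  have notBoth: "\<not> (x'' \<in> K \<and> y'' \<in> K)" if K: "K = B \<or> K = C" for K
  proof
    assume "x'' \<in> K \<and> y'' \<in> K"
    then obtain S where "geodesic_segment X x'' y'' S" "S \<subseteq> K"
      using K B C geodesic_subsegment by metis
    then show False
      using same_side_imp_False[OF cutx cuty] K by blast
  qed
  have xy: "dist x p + dist p y = dist x y" "dist x x' + dist x' y = dist x y"
      "dist x y' + dist y' y = dist x y"
    using geodesic_segment_between[OF A] pA x' y' by blast+
  have "x'' \<in> C \<and> y'' \<in> B"
  proof (rule ccontr)
    assume "\<not> ?thesis"
    then have cr: "x'' \<in> B" "x'' \<notin> C" "y'' \<in> C" "y'' \<notin> B"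
      using notBoth[of B] notBoth[of C] x'(4) y'(4) by blast+
    \<comment> \<open>The sides \<open>B\<close> and \<open>C\<close> cross. Then neither cut is made at a vertex, so both cuts are at
      distance exactly \<open>5/4 * D\<close> from \<open>p\<close>; but adding the lengths of \<open>B\<close> and \<open>C\<close> shows that \<open>x'\<close> and
      \<open>y'\<close> are at most \<open>2 * D\<close> apart.\<close>
    have s: "dist p x' = 5/4 * D" "dist p y' = 5/4 * D" using cr x'(6) y'(6) by blast+
    have "dist p x' = \<bar>dist x p - dist x x'\<bar>" "dist p y' = \<bar>dist y p - dist y y'\<bar>"
      using geodesic_segment_dist[OF A pA x'(1)] geodesic_segment_dist[OF s.A pA y'(1)] by blast+
    then have e: "dist x x' = dist x p - 5/4 * D" "dist y y' = dist y p - 5/4 * D"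
      using s x'(2) y'(2) by linarith+
    have "dist x y'' + dist y'' z = dist x z" "dist y x'' + dist x'' z = dist y z"
      using geodesic_segment_between[OF C cr(3)] geodesic_segment_between[OF B cr(1)] by blast+
    moreover have "dist x z \<le> dist x x' + dist x' x'' + dist x'' z"
      using dist_triangle[of x z x'] dist_triangle[of x' z x''] by linarith
    moreover have "dist y z \<le> dist y y' + dist y' y'' + dist y'' z"
      using dist_triangle[of y z y'] dist_triangle[of y' z y''] by linarith
    moreover have "dist x y' \<le> dist x y'' + dist y' y''" "dist y x' \<le> dist y x'' + dist x' x''"
      using dist_triangle[of x y' y''] dist_triangle[of y x' x''] by (simp_all add: dist_commute)
    ultimately show False using e xy x'(5) y'(5) D by (simp add: dist_commute)
  qed
  then have xC: "x'' \<in> C" and yB: "y'' \<in> B" by auto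
  have le: "dist x x' \<le> dist x y'" using xy x'(2) y'(2) by (simp add: dist_commute)
  \<comment> \<open>The points within \<open>D\<close> of \<open>B\<close> and those within \<open>D\<close> of \<open>C\<close> form two nonempty closed sets covering
    the segment \<open>M\<close>, which is connected.\<close>
  obtain M where M: "geodesic_segment X x' y' M" "M \<subseteq> A"
    using geodesic_subsegment[OF A x'(1) y'(1)] .
  have comp: "compact B" "compact C" "B \<noteq> {}" "C \<noteq> {}"
    using B C geodesic_segment_compact_connected geodesic_segment_ends by blast+
  define F where "F K = {u. infdist u K \<le> D}" for K :: "'a set"
  have F: "closed (F K)" for K
    unfolding F_def by (intro closed_Collect_le continuous_intros)
  have inF: "u \<in> F K" if "q \<in> K" "dist u q \<le> D" for u q K
    unfolding F_def using infdist_le[OF that(1), of u] that(2) by simp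
  have "M \<subseteq> F B \<union> F C"
  proof
    fix u assume "u \<in> M"
    then obtain q where "q \<in> B \<union> C" "dist u q \<le> D" using nearA M by blast
    then show "u \<in> F B \<union> F C" using inF by blast
  qed
  moreover have "y' \<in> F B \<inter> M" "x' \<in> F C \<inter> M"
    using inF[OF yB y'(5)] inF[OF xC x'(5)] geodesic_segment_ends[OF M(1)] by blast+
  ultimately have "F B \<inter> F C \<inter> M \<noteq> {}"
    using geodesic_segment_compact_connected(2)[OF M(1)] F unfolding connected_closed by blast
  then obtain u where u: "u \<in> M" "infdist u B \<le> D" "infdist u C \<le> D"
    unfolding F_def by blast
  obtain b where b: "b \<in> B" "dist u b \<le> D" using compact_infdist_le[OF comp(1,3) u(2)] .
  obtain c where c: "c \<in> C" "dist u c \<le> D" using compact_infdist_le[OF comp(2,4) u(3)] .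
  have uA: "u \<in> A" using u M by blast
  have xu: "dist x u + dist u y = dist x y" using geodesic_segment_between[OF A uA] .
  have "dist x' u + dist u y' = dist x' y'" using geodesic_segment_between[OF M(1) u(1)] .
  moreover have "dist x' u = \<bar>dist x x' - dist x u\<bar>" "dist u y' = \<bar>dist x u - dist x y'\<bar>"
      "dist x' y' = \<bar>dist x x' - dist x y'\<bar>" "dist p x' = \<bar>dist x p - dist x x'\<bar>"
      "dist p y' = \<bar>dist x p - dist x y'\<bar>" "dist p u = \<bar>dist x p - dist x u\<bar>"
    using geodesic_segment_dist[OF A] x'(1) y'(1) uA pA by blast+
  ultimately have pu: "dist p u \<le> 5/4 * D" using x'(2,3) y'(3) le by linarith
  show False
  proof (cases "dist x p \<le> dist x u")
    case True
    have "dist p c \<le> 3/2 * D"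
      by (rule close_to_C[OF cutx xC uA True pu c])
    then show False by (rule close_to_C_imp_False[OF cutx xC cuty yB c(1)])
  next
    case False
    then have "dist y p \<le> dist y u" using xu xy by (simp add: dist_commute)
    then have "dist p b \<le> 3/2 * D"
      using s.close_to_C[OF cuty yB uA _ pu b] by blast
    then show False by (rule s.close_to_C_imp_False[OF cuty yB cutx xC b(1)])
  qed
qed

end


section \<open>The characterization\<close>

lemma geodesic_triangle_rotate:
  "geodesic_triangle X x y z A B C \<Longrightarrow> geodesic_triangle X y z x B C A"
  unfolding geodesic_triangle_def by blast

lemma rips_rotate: "rips A B C d \<Longrightarrow> rips B C A d"
  unfolding rips_def by (simp add: Un_commute)

lemma rips_mono: "rips A B C d \<Longrightarrow> d \<le> e \<Longrightarrow> rips A B C e"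
  unfolding rips_def by (meson order_trans)

context thin_space
begin

text \<open>The point \<open>p\<close> is assumed to realise the largest distance of a point of a side from the other
  two sides.\<close>

lemma attained_rips_constant_le:
  assumes tri: "geodesic_triangle X x y z A B C" and p: "p \<in> A" and T: "0 < T"
    and r: "rips A B C (infdist p (B \<union> C))"
  shows "infdist p (B \<union> C) \<le> T"
proof (rule ccontr)
  define D where "D = infdist p (B \<union> C)"
  assume "\<not> ?thesis"
  then have D: "T < D" unfolding D_def by simp
  have A: "geodesic_segment X x y A" and B: "geodesic_segment X y z B"
    and C: "geodesic_segment X z x C" using tri unfolding geodesic_triangle_def by auto
  note * = geodesic_segment_compact_connected(1) geodesic_segment_ends(1)
  have near: "\<exists>q\<in>K \<union> K'. dist a q \<le> D"
    if "infdist a (K \<union> K') \<le> D" "K \<in> {A, B, C}" "K' \<in> {A, B, C}" for a K K'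
  proof -
    have "compact (K \<union> K')" "K \<union> K' \<noteq> {}" using that(2,3) *[OF A] *[OF B] *[OF C] by auto
    then show ?thesis using compact_infdist_le that(1) by metis
  qed
  have "fat_triangle X T x y z A B C p D"
  proof unfold_locales
    show "geodesic_segment X x y A" "geodesic_segment X y z B" "p \<in> A" by fact+
    show "geodesic_segment X x z C" using geodesic_segment_reverse[OF C] .
    show "0 < D" "T \<le> D" using D T by auto
    show "D \<le> dist p q" if "q \<in> B \<union> C" for q unfolding D_def using infdist_le[OF that] .
    show "\<exists>q\<in>B \<union> C. dist a q \<le> D" if "a \<in> A" for a
      by (rule near) (use r that in \<open>auto simp: rips_def D_def\<close>)
    show "\<exists>q\<in>A \<union> C. dist b q \<le> D" if "b \<in> B" for b
      by (rule near) (use r that in \<open>auto simp: rips_def D_def Un_commute\<close>)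
    show "\<exists>q\<in>A \<union> B. dist c q \<le> D" if "c \<in> C" for c
      by (rule near) (use r that in \<open>auto simp: rips_def D_def\<close>)
  qed
  then show False by (rule fat_triangle.contradiction)
qed

lemma rips_threshold:
  assumes tri: "geodesic_triangle X x y z A B C" and T: "0 < T"
  shows "rips A B C T"
proof -
  note tri2 = geodesic_triangle_rotate[OF tri]
  note tri3 = geodesic_triangle_rotate[OF tri2]
  have max: "\<exists>p\<in>K. \<forall>q\<in>K. infdist q S \<le> infdist p S"
    if "geodesic_segment X a b K" for a b K S
    by (rule continuous_attains_sup)
      (use geodesic_segment_compact_connected[OF that] geodesic_segment_ends[OF that] in
        \<open>auto intro!: continuous_intros\<close>)
  obtain a where a: "a \<in> A" "\<forall>q\<in>A. infdist q (B \<union> C) \<le> infdist a (B \<union> C)"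
    using max tri unfolding geodesic_triangle_def by blast
  obtain b where b: "b \<in> B" "\<forall>q\<in>B. infdist q (C \<union> A) \<le> infdist b (C \<union> A)"
    using max tri unfolding geodesic_triangle_def by blast
  obtain c where c: "c \<in> C" "\<forall>q\<in>C. infdist q (A \<union> B) \<le> infdist c (A \<union> B)"
    using max tri unfolding geodesic_triangle_def by blast
  define D where "D = Max {infdist a (B \<union> C), infdist b (C \<union> A), infdist c (A \<union> B)}"
  have le: "infdist a (B \<union> C) \<le> D" "infdist b (C \<union> A) \<le> D" "infdist c (A \<union> B) \<le> D"
    unfolding D_def by auto
  have r: "rips A B C D" unfolding rips_def using a b c le by (meson order_trans)
  have "D \<in> {infdist a (B \<union> C), infdist b (C \<union> A), infdist c (A \<union> B)}"
    unfolding D_def by (rule Max_in) auto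
  then have "D \<le> T"
    using attained_rips_constant_le[OF tri a(1) T] attained_rips_constant_le[OF tri2 b(1) T]
      attained_rips_constant_le[OF tri3 c(1) T] r rips_rotate[OF r] rips_rotate[OF rips_rotate[OF r]]
    by auto
  with r show ?thesis by (rule rips_mono)
qed

end

lemma triangle_delta_le_Omega:
  assumes "geodesic_triangle X x y z A B C" "perimeter x y z \<le> t"
  shows "triangle_delta A B C \<le> Omega X t"
  unfolding Omega_def by (rule Sup_upper) (use assms in blast)

lemma triangle_delta_less_imp_rips:
  assumes "triangle_delta A B C < ereal d"
  shows "rips A B C d"
proof -
  obtain e where "rips A B C e" "ereal e < ereal d"
    using assms unfolding triangle_delta_def Inf_less_iff by blast
  then show ?thesis by (auto intro: rips_mono)
qed

lemma Omega_le_if_delta_hyperbolic: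
  assumes "delta_hyperbolic X d"
  shows "Omega X t \<le> ereal d"
  unfolding Omega_def
proof (rule Sup_least)
  fix e assume "e \<in> {triangle_delta A B C | x y z A B C.
     geodesic_triangle X x y z A B C \<and> perimeter x y z \<le> t}"
  then obtain x y z A B C where e: "e = triangle_delta A B C" "geodesic_triangle X x y z A B C"
    by blast
  then have "rips A B C d" using assms unfolding delta_hyperbolic_def by blast
  then show "e \<le> ereal d" unfolding e triangle_delta_def by (intro Inf_lower) blast
qed

theorem theorem1:
  fixes X :: "'a::metric_space set"
  assumes "geodesic_space X"
  shows "hyperbolic X \<longleftrightarrow> Limsup at_top (\<lambda>t::real. Omega X t / ereal t) < ereal (1 / 32)"
proof
  assume "hyperbolic X"
  then obtain d where d: "0 \<le> d" "delta_hyperbolic X d" unfolding hyperbolic_def by blast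
  have "eventually (\<lambda>t::real. Omega X t / ereal t \<le> ereal (1 / 64)) at_top"
    using eventually_ge_at_top[of "64 * d + 1"]
  proof eventually_elim
    case (elim t)
    then have t: "0 < t" using d by linarith
    have "Omega X t / ereal t \<le> ereal d / ereal t"
      by (rule ereal_divide_right_mono) (use Omega_le_if_delta_hyperbolic[OF d(2)] t in auto)
    also have "\<dots> \<le> ereal (1 / 64)" using elim t by (simp add: field_simps)
    finally show ?case .
  qed
  then have "Limsup at_top (\<lambda>t::real. Omega X t / ereal t) \<le> ereal (1 / 64)"
    by (rule Limsup_bounded)
  also have "\<dots> < ereal (1 / 32)" by simp
  finally show "Limsup at_top (\<lambda>t::real. Omega X t / ereal t) < ereal (1 / 32)" .
next
  assume "Limsup at_top (\<lambda>t::real. Omega X t / ereal t) < ereal (1 / 32)"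
  then have "eventually (\<lambda>t::real. Omega X t / ereal t < ereal (1 / 32)) at_top"
    by (rule Limsup_lessD)
  then obtain T0 where T0: "\<And>t. T0 \<le> t \<Longrightarrow> Omega X t / ereal t < ereal (1 / 32)"
    unfolding eventually_at_top_linorder by blast
  define T where "T = max T0 1"
  have T: "0 < T" unfolding T_def by simp
  interpret thin_space X T
  proof
    show "geodesic_space X" by fact
    fix u x y z A B C
    assume u: "T \<le> u" and tri: "geodesic_triangle X x y z A B C" "perimeter x y z \<le> u"
    have "0 < u" "T0 \<le> u" using u T unfolding T_def by auto
    then have "Omega X u < ereal (u / 32)"
      using T0[of u] by (simp add: ereal_divide_less_iff)
    then show "rips A B C (u / 32)"
      using triangle_delta_le_Omega[OF tri] by (intro triangle_delta_less_imp_rips) (rule le_less_trans)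
  qed
  show "hyperbolic X"
    unfolding hyperbolic_def delta_hyperbolic_def
    using assms rips_threshold T by (intro exI[of _ T]) auto
qed

end
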